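(* Let $s\ge 2$ be an integer and $A_s=\{e_0,\dots,e_{s-1}\}$ with $0<e_0<e_1<\dots<e_{s-1}$. If $e_i-e_{i-1}>d_1-d_0$ for all $i\in\{1,2,\dots,s-1\}$, then the set $E$ of values of all infinite $A_s$-continued fractions is nowhere dense and has Lebesgue measure zero.
   Context: For a sequence $(a_n)_{n\ge1}$ with $a_n\in A_s$, $[0;a_1,a_2,\dots]$ denotes the value of the infinite continued fraction $\cfrac{1}{a_1+\cfrac{1}{a_2+\cdots}}$, i.e. the limit of its convergents, which exists for all such sequences. $E=\{[0;a_1,a_2,\dots]: a_n\in A_s\text{ for all } n\}$. Put $p=e_0e_{s-1}$, $d_0=\min E=\dfrac{\sqrt{p(p+4)}-p}{2e_{s-1}}$ and $d_1=\max E=\dfrac{\sqrt{p(p+4)}-p}{2e_0}$. *)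

theory Defs
  imports "HOL-Analysis.Analysis"
begin

text \<open>
  Sequences of partial denominators are indexed from 1; the value at index 0 is irrelevant.
  The convergent \<open>cf_convergent a n\<close> is $[0; a_1, \dots, a_n]$.
\<close>

primrec cf_convergent :: "(nat \<Rightarrow> real) \<Rightarrow> nat \<Rightarrow> real" where
  "cf_convergent a 0 = 0"
| "cf_convergent a (Suc n) = 1 / (a 1 + cf_convergent (\<lambda>k. a (Suc k)) n)"

definition cf_value :: "(nat \<Rightarrow> real) \<Rightarrow> real" where
  "cf_value a = lim (cf_convergent a)"

definition cf_values :: "real set \<Rightarrow> real set" where
  "cf_values A = {cf_value a | a. \<forall>n\<ge>1. a n \<in> A}"

text \<open>
  For a digit set with least element \<open>l\<close> and greatest element \<open>g\<close>, these are the least and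
  the greatest element of \<open>cf_values\<close>; see \<open>cf_min_least\<close> and \<open>cf_max_greatest\<close> below.
\<close>

definition cf_min :: "real \<Rightarrow> real \<Rightarrow> real" where
  "cf_min l g = (let p = l * g in (sqrt (p * (p + 4)) - p) / (2 * g))"

definition cf_max :: "real \<Rightarrow> real \<Rightarrow> real" where
  "cf_max l g = (let p = l * g in (sqrt (p * (p + 4)) - p) / (2 * l))"

definition nowhere_dense :: "'a::topological_space set \<Rightarrow> bool" where
  "nowhere_dense S \<longleftrightarrow> interior (closure S) = {}"

lemma cf_convergent_nonneg:
  assumes "\<And>n. n \<ge> 1 \<Longrightarrow> 0 < a n"
  shows "0 \<le> cf_convergent a n"
  using assms
proof (induction n arbitrary: a)
  case (Suc n)
  have "0 \<le> cf_convergent (\<lambda>k. a (Suc k)) n" by (rule Suc.IH) (simp add: Suc.prems)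
  moreover have "0 < a 1" by (rule Suc.prems) simp
  ultimately show ?case by simp
qed simp

lemma cf_convergent_le:
  assumes "0 < m" "\<And>n. n \<ge> 1 \<Longrightarrow> m \<le> a n"
  shows "cf_convergent a n \<le> 1 / m"
proof (cases n)
  case (Suc k)
  have "0 \<le> cf_convergent (\<lambda>k. a (Suc k)) k"
    by (rule cf_convergent_nonneg) (meson assms less_le_trans le_SucI)
  moreover have "m \<le> a 1" by (rule assms) simp
  ultimately show ?thesis using Suc \<open>0 < m\<close> by (simp add: frac_le)
qed (use assms in simp)

lemma cf_two_step_contraction:
  fixes a b m x y :: real
  assumes "0 < m" "m \<le> a" "m \<le> b" "0 \<le> x" "0 \<le> y"
  shows "\<bar>1 / (b + 1 / (a + x)) - 1 / (b + 1 / (a + y))\<bar> \<le> 1 / (1 + m\<^sup>2) * \<bar>x - y\<bar>"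
proof -
  have pos: "0 < a" "0 < b" "0 < a + x" "0 < a + y" using assms by auto
  have mm: "m\<^sup>2 \<le> b * (a + z)" if "0 \<le> z" for z
    unfolding power2_eq_square using assms that by (intro mult_mono) auto
  define u where "u = 1 + b * (a + x)"
  define v where "v = 1 + b * (a + y)"
  have u: "1 + m\<^sup>2 \<le> u" and v: "1 + m\<^sup>2 \<le> v"
    unfolding u_def v_def using mm[OF assms(4)] mm[OF assms(5)] by auto
  have m1: "1 \<le> 1 + m\<^sup>2" by simp
  have up: "0 < u" "0 < v" "1 \<le> v" using u v m1 by linarith+
  have 1: "1 / (b + 1 / (a + x)) = (a + x) / u" "1 / (b + 1 / (a + y)) = (a + y) / v"
    unfolding u_def v_def using pos by (simp_all add: divide_simps algebra_simps)
  have "(a + x) / u - (a + y) / v = ((a + x) * v - (a + y) * u) / (u * v)"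
    using up by (simp add: divide_simps)
  also have "(a + x) * v - (a + y) * u = x - y"
    unfolding u_def v_def by (simp add: algebra_simps)
  finally have 2: "\<bar>(a + x) / u - (a + y) / v\<bar> = 1 / (u * v) * \<bar>x - y\<bar>"
    using up by (simp add: abs_mult)
  have "(1 + m\<^sup>2) * 1 \<le> u * v" using u up m1 by (intro mult_mono) linarith+
  then have "1 / (u * v) \<le> 1 / (1 + m\<^sup>2)" by (intro frac_le) (use m1 in \<open>simp_all add: add_pos_nonneg\<close>)
  then show ?thesis unfolding 1 2 by (intro mult_right_mono) auto
qed

lemma cf_convergent_dist:
  assumes "0 < m" "\<And>n. n \<ge> 1 \<Longrightarrow> m \<le> a n"
  shows "\<bar>cf_convergent a (n + k) - cf_convergent a n\<bar> \<le> (1 / (1 + m\<^sup>2)) ^ (n div 2) * (1 / m)"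
  using assms(2)
proof (induction n arbitrary: a rule: nat_less_induct)
  case (1 n)
  have pos: "0 < a n" if "n \<ge> 1" for n using 1(2)[OF that] assms(1) by linarith
  show ?case
  proof (cases "n < 2")
    case True
    have "0 \<le> cf_convergent a (n + k)" "0 \<le> cf_convergent a n"
      using pos by (auto intro!: cf_convergent_nonneg)
    moreover have "cf_convergent a (n + k) \<le> 1 / m" "cf_convergent a n \<le> 1 / m"
      using 1 assms(1) by (auto intro!: cf_convergent_le)
    ultimately show ?thesis using True by simp
  next
    case False
    then obtain j where j: "n = Suc (Suc j)" by (metis add_2_eq_Suc le_Suc_ex not_less)
    define a' where "a' = (\<lambda>k. a (Suc (Suc k)))"
    have IH: "\<bar>cf_convergent a' (j + k) - cf_convergent a' j\<bar> \<le> (1 / (1 + m\<^sup>2)) ^ (j div 2) * (1 / m)"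
      using 1 j unfolding a'_def by auto
    have nn: "0 \<le> cf_convergent a' i" for i
      unfolding a'_def using pos by (auto intro!: cf_convergent_nonneg)
    have "\<bar>cf_convergent a (n + k) - cf_convergent a n\<bar>
        \<le> 1 / (1 + m\<^sup>2) * \<bar>cf_convergent a' (j + k) - cf_convergent a' j\<bar>"
      using cf_two_step_contraction[OF assms(1) 1(2)[of 2] 1(2)[of 1] nn nn]
      by (simp add: j a'_def numeral_2_eq_2)
    also have "\<dots> \<le> 1 / (1 + m\<^sup>2) * ((1 / (1 + m\<^sup>2)) ^ (j div 2) * (1 / m))"
      by (rule mult_left_mono[OF IH]) simp
    finally show ?thesis using j by simp
  qed
qed

lemma cf_convergent_LIMSEQ:
  assumes "0 < m" "\<And>n. n \<ge> 1 \<Longrightarrow> m \<le> a n"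
  shows "cf_convergent a \<longlonglongrightarrow> cf_value a"
proof -
  define c where "c = 1 / (1 + m\<^sup>2)"
  have "1 < 1 + m\<^sup>2" using assms(1) by simp
  moreover from this have "0 < 1 + m\<^sup>2" by linarith
  ultimately have c: "0 \<le> c" "c < 1" unfolding c_def by (simp_all add: divide_less_eq_1)
  have c0: "(\<lambda>n. c ^ n * (1 / m)) \<longlonglongrightarrow> 0"
    using LIMSEQ_realpow_zero[OF c] by (rule tendsto_mult_left_zero)
  have "Cauchy (cf_convergent a)"
  proof (rule CauchyI')
    fix e :: real assume "0 < e"
    then have "eventually (\<lambda>n. c ^ n * (1 / m) < e) sequentially"
      using c0 by (rule order_tendstoD(2)[rotated])
    then obtain N where N: "\<And>n. n \<ge> N \<Longrightarrow> c ^ n * (1 / m) < e"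
      by (auto simp: eventually_sequentially)
    show "\<exists>M. \<forall>i\<ge>M. \<forall>j>i. dist (cf_convergent a i) (cf_convergent a j) < e"
    proof (intro exI allI impI)
      fix i j assume ij: "2 * N \<le> i" "i < j"
      then have "N \<le> i div 2" by linarith
      then show "dist (cf_convergent a i) (cf_convergent a j) < e"
        using cf_convergent_dist[of m a i "j - i", OF assms] ij N[of "i div 2"]
        by (simp add: c_def dist_real_def abs_minus_commute)
    qed
  qed
  then show ?thesis
    unfolding cf_value_def by (simp add: Cauchy_convergent_iff convergent_LIMSEQ_iff)
qed

lemma cf_convergent_bounds:
  assumes "0 < l" "\<And>n. n \<ge> 1 \<Longrightarrow> l \<le> a n \<and> a n \<le> g"
  shows "cf_convergent (\<lambda>k. if odd k then g else l) n \<le> cf_convergent a n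
    \<and> cf_convergent a n \<le> cf_convergent (\<lambda>k. if odd k then l else g) n"
  using assms(2)
proof (induction n arbitrary: a)
  case (Suc n)
  have g: "l \<le> g" using Suc.prems[of 1] by simp
  let ?lg = "\<lambda>k::nat. if odd k then l else g" and ?gl = "\<lambda>k::nat. if odd k then g else l"
  have IH: "cf_convergent ?gl n \<le> cf_convergent (\<lambda>k. a (Suc k)) n"
    "cf_convergent (\<lambda>k. a (Suc k)) n \<le> cf_convergent ?lg n"
    using Suc.IH[of "\<lambda>k. a (Suc k)"] Suc.prems by auto
  have nn: "0 \<le> cf_convergent ?gl n"
    using assms(1) g by (intro cf_convergent_nonneg) auto
  have sw: "(\<lambda>k. ?gl (Suc k)) = ?lg" "(\<lambda>k. ?lg (Suc k)) = ?gl" by auto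
  have a1: "l \<le> a 1" "a 1 \<le> g" using Suc.prems[of 1] by auto
  have "1 / (g + cf_convergent ?lg n) \<le> 1 / (a 1 + cf_convergent (\<lambda>k. a (Suc k)) n)"
    using a1 IH nn assms(1) by (intro frac_le) auto
  moreover have "1 / (a 1 + cf_convergent (\<lambda>k. a (Suc k)) n) \<le> 1 / (l + cf_convergent ?gl n)"
    using a1 IH nn assms(1) by (intro frac_le) auto
  ultimately show ?case unfolding cf_convergent.simps sw by simp
qed simp

lemma cf_value_unfold:
  assumes "0 < m" "\<And>n. n \<ge> 1 \<Longrightarrow> m \<le> a n"
  shows "cf_value a = 1 / (a 1 + cf_value (\<lambda>k. a (Suc k)))" and "0 \<le> cf_value a"
proof -
  have tail: "cf_convergent (\<lambda>k. a (Suc k)) \<longlonglongrightarrow> cf_value (\<lambda>k. a (Suc k))"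
    using assms by (intro cf_convergent_LIMSEQ) auto
  have nn: "0 \<le> cf_convergent b n" if "\<And>n. n \<ge> 1 \<Longrightarrow> m \<le> b n" for b n
    by (rule cf_convergent_nonneg) (meson assms(1) less_le_trans that)
  have "0 \<le> cf_value (\<lambda>k. a (Suc k))"
    by (rule LIMSEQ_le_const[OF tail]) (auto intro!: nn assms)
  moreover have "0 < a 1" using assms(1) assms(2)[of 1] by linarith
  ultimately have "(\<lambda>n. cf_convergent a (Suc n)) \<longlonglongrightarrow> 1 / (a 1 + cf_value (\<lambda>k. a (Suc k)))"
    by (auto intro!: tendsto_intros tail)
  moreover have "(\<lambda>n. cf_convergent a (Suc n)) \<longlonglongrightarrow> cf_value a"
    using cf_convergent_LIMSEQ[OF assms] by (rule LIMSEQ_Suc)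
  ultimately show "cf_value a = 1 / (a 1 + cf_value (\<lambda>k. a (Suc k)))"
    by (rule LIMSEQ_unique[rotated])
  show "0 \<le> cf_value a"
    by (rule LIMSEQ_le_const[OF cf_convergent_LIMSEQ[OF assms]]) (auto intro!: nn assms)
qed

lemma cf_periodic_root:
  fixes x l g :: real
  assumes "0 < l" "0 < g" "0 \<le> x" "x = 1 / (g + 1 / (l + x))"
  shows "x = (sqrt (l * g * (l * g + 4)) - l * g) / (2 * g)"
proof -
  have lx: "0 < l + x" using assms by simp
  have den: "0 < g + 1 / (l + x)" using assms(2) lx by (intro add_pos_pos) auto
  have x1: "x * (g + 1 / (l + x)) = 1" using assms(4) den by (metis less_irrefl nonzero_divide_eq_eq)
  have "x * (g * (l + x) + 1) = x * (g + 1 / (l + x)) * (l + x)"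
    using lx by (simp add: field_simps)
  with x1 have q: "x * (g * (l + x) + 1) = l + x" by simp
  have "(2 * g * x + l * g)\<^sup>2 = 4 * g * (x * (g * (l + x) + 1) - x) + (l * g)\<^sup>2"
    by (simp add: algebra_simps power2_eq_square)
  also have "\<dots> = l * g * (l * g + 4)" unfolding q by (simp add: algebra_simps power2_eq_square)
  finally have "sqrt (l * g * (l * g + 4)) = 2 * g * x + l * g"
    using assms by (intro real_sqrt_unique) auto
  then show ?thesis using assms by simp
qed

lemma cf_value_periodic:
  assumes "0 < l" "l \<le> g"
  shows "cf_value (\<lambda>k. if odd k then g else l) = cf_min l g"
    and "cf_value (\<lambda>k. if odd k then l else g) = cf_max l g"
proof -
  let ?lg = "\<lambda>k::nat. if odd k then l else g" and ?gl = "\<lambda>k::nat. if odd k then g else l"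
  have sw: "(\<lambda>k. ?gl (Suc k)) = ?lg" "(\<lambda>k. ?lg (Suc k)) = ?gl" by auto
  have u: "cf_value ?gl = 1 / (g + cf_value ?lg)" "0 \<le> cf_value ?gl"
    using cf_value_unfold[of l ?gl] assms sw by auto
  have v: "cf_value ?lg = 1 / (l + cf_value ?gl)" "0 \<le> cf_value ?lg"
    using cf_value_unfold[of l ?lg] assms sw by auto
  show "cf_value ?gl = cf_min l g"
    unfolding cf_min_def Let_def
    by (rule cf_periodic_root) (use assms u v in auto)
  have "cf_value ?lg = (sqrt (g * l * (g * l + 4)) - g * l) / (2 * l)"
    by (rule cf_periodic_root) (use assms u v in auto)
  then show "cf_value ?lg = cf_max l g"
    unfolding cf_max_def Let_def by (simp add: mult.commute)
qed

lemma cf_min_least: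
  assumes "0 < l" "l \<in> A" "g \<in> A" "\<And>x. x \<in> A \<Longrightarrow> l \<le> x \<and> x \<le> g"
  shows "cf_min l g \<in> cf_values A" and "\<And>x. x \<in> cf_values A \<Longrightarrow> cf_min l g \<le> x"
proof -
  let ?gl = "\<lambda>k::nat. if odd k then g else l"
  have lg: "l \<le> g" using assms by blast
  show "cf_min l g \<in> cf_values A"
    unfolding cf_values_def cf_value_periodic(1)[OF assms(1) lg, symmetric] using assms(2,3) by fastforce
  fix x assume "x \<in> cf_values A"
  then obtain a where a: "x = cf_value a" "\<And>n. n \<ge> 1 \<Longrightarrow> a n \<in> A" by (auto simp: cf_values_def)
  have 1: "cf_convergent ?gl \<longlonglongrightarrow> cf_value ?gl" "cf_convergent a \<longlonglongrightarrow> cf_value a"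
    using a(2) assms lg by (auto intro!: cf_convergent_LIMSEQ[OF assms(1)])
  show "cf_min l g \<le> x"
    unfolding a(1) cf_value_periodic(1)[OF assms(1) lg, symmetric]
    by (rule LIMSEQ_le[OF 1]) (use cf_convergent_bounds[OF assms(1), of a g] a(2) assms(4) in blast)
qed

lemma cf_max_greatest:
  assumes "0 < l" "l \<in> A" "g \<in> A" "\<And>x. x \<in> A \<Longrightarrow> l \<le> x \<and> x \<le> g"
  shows "cf_max l g \<in> cf_values A" and "\<And>x. x \<in> cf_values A \<Longrightarrow> x \<le> cf_max l g"
proof -
  let ?lg = "\<lambda>k::nat. if odd k then l else g"
  have lg: "l \<le> g" using assms by blast
  show "cf_max l g \<in> cf_values A"
    unfolding cf_values_def cf_value_periodic(2)[OF assms(1) lg, symmetric] using assms(2,3) by fastforce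
  fix x assume "x \<in> cf_values A"
  then obtain a where a: "x = cf_value a" "\<And>n. n \<ge> 1 \<Longrightarrow> a n \<in> A" by (auto simp: cf_values_def)
  have 1: "cf_convergent a \<longlonglongrightarrow> cf_value a" "cf_convergent ?lg \<longlonglongrightarrow> cf_value ?lg"
    using a(2) assms lg by (auto intro!: cf_convergent_LIMSEQ[OF assms(1)])
  show "x \<le> cf_max l g"
    unfolding a(1) cf_value_periodic(2)[OF assms(1) lg, symmetric]
    by (rule LIMSEQ_le[OF 1]) (use cf_convergent_bounds[OF assms(1), of a g] a(2) assms(4) in blast)
qed

end

theory Submission
  imports Defs
begin

text \<open>
  Let \<open>l\<close> and \<open>g\<close> be the least and the greatest digit, \<open>d\<^sub>0 = cf_min l g\<close>, \<open>d\<^sub>1 = cf_max l g\<close>, and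
  let \<open>K\<close> be the closure of the set of values.  Then \<open>K\<close> is a compact subset of \<open>{d\<^sub>0..d\<^sub>1}\<close>
  covered by its images under the branches \<open>x \<mapsto> 1 / (a + x)\<close>, one for each digit \<open>a\<close>.  Both claims
  follow once \<open>K\<close> has measure zero, since a nonempty open set does not.

  Up to a translation and a reflection, a composition of branches whose last convergents have
  denominators \<open>q'\<close> and \<open>q\<close> is \<open>x \<mapsto> x / (1 + t * x) / q\<^sup>2\<close> with \<open>t = q' / q\<close>.  The distortion is
  thus governed by a single parameter \<open>t\<close>, which stays in \<open>{0..1 / l}\<close> and moves to \<open>1 / (a + t)\<close>
  when a further branch \<open>a\<close> is appended (\<open>cf_shear_branch\<close>).  Writing \<open>m t\<close> for the measure of
  the image of \<open>K\<close> under \<open>x \<mapsto> x / (1 + t * x)\<close>, subadditivity gives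
  \<open>m t \<le> (\<Sum>a. m (1 / (a + t)) / (a + t)\<^sup>2)\<close> (\<open>measure_cf_shear_le\<close>).

  Let \<open>T t\<close> be the length of the image of the whole interval \<open>{d\<^sub>0..d\<^sub>1}\<close>, so \<open>m t \<le> T t\<close>.
  Replacing \<open>m\<close> by \<open>T\<close> on the right-hand side above yields the total length of the images of the
  first-level intervals.  By the hypothesis on the digits these are separated by gaps, whose total
  length is bounded below uniformly in \<open>t\<close>, so that this sum is at most \<open>r * T t\<close> for a constant
  \<open>r < 1\<close> (\<open>cf_shear_contraction\<close>).  Iteration gives \<open>m t \<le> r ^ n * T t\<close> for all \<open>n\<close>, and
  \<open>t = 0\<close> is the assertion that \<open>K\<close> is a null set.
\<close>

section \<open>Normalised compositions of branches\<close>

text \<open>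
  The map \<open>cf_shear t\<close> represents all compositions of branches with ratio \<open>t\<close> of consecutive
  convergent denominators, normalised by an affine map so that it fixes 0 with derivative 1 there.
\<close>

definition cf_shear :: "real \<Rightarrow> real \<Rightarrow> real" where
  "cf_shear t x = x / (1 + t * x)"

lemma cf_shear_0 [simp]: "cf_shear 0 x = x"
  by (simp add: cf_shear_def)

lemma cf_shear_mono:
  assumes "0 \<le> t" "0 \<le> x" "x \<le> y"
  shows "cf_shear t x \<le> cf_shear t y"
proof -
  have "0 < 1 + t * x" "0 < 1 + t * y" using assms by (auto intro!: add_pos_nonneg)
  then show ?thesis
    unfolding cf_shear_def using assms by (simp add: divide_simps) (simp add: algebra_simps)
qed

lemma continuous_on_cf_shear:
  assumes "0 \<le> t" "\<And>x. x \<in> K \<Longrightarrow> 0 \<le> x"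
  shows "continuous_on K (cf_shear t)"
proof -
  have "1 + t * x \<noteq> 0" if "x \<in> K" for x
    using mult_nonneg_nonneg[OF assms(1) assms(2)[OF that]] by linarith
  then show ?thesis unfolding cf_shear_def by (intro continuous_intros) auto
qed

lemma cf_shear_recip:
  assumes "0 < a" "0 \<le> t" "0 \<le> x"
  shows "cf_shear t (1 / (a + x)) = 1 / (a + t + x)"
proof -
  have "0 < a + x" "0 < a + t + x" using assms by auto
  then show ?thesis by (simp add: cf_shear_def divide_simps add.commute add.left_commute)
qed

lemma cf_shear_scaled:
  assumes "0 < a" "0 \<le> t" "0 \<le> x"
  shows "cf_shear (1 / (a + t)) x / (a + t)\<^sup>2 = 1 / (a + t) - 1 / (a + t + x)"
proof -
  define b where "b = a + t"
  have "0 < b" "0 < b + x" using assms by (auto simp: b_def)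
  then have "cf_shear (1 / b) x / b\<^sup>2 = 1 / b - 1 / (b + x)"
    by (simp add: cf_shear_def divide_simps) (simp add: algebra_simps power2_eq_square)
  then show ?thesis by (simp add: b_def)
qed

lemma cf_shear_branch:
  assumes "0 < a" "0 \<le> t" "0 \<le> x"
  shows "cf_shear t (1 / (a + x)) = 1 / (a + t) - cf_shear (1 / (a + t)) x / (a + t)\<^sup>2"
  using cf_shear_recip[OF assms] cf_shear_scaled[OF assms] by simp

lemma measure_cf_shear_le:
  assumes "finite A" "\<And>a. a \<in> A \<Longrightarrow> 0 < a" "0 \<le> t"
    and K: "compact K" "\<And>x. x \<in> K \<Longrightarrow> 0 \<le> x"
    and cover: "K \<subseteq> (\<Union>a\<in>A. (\<lambda>x. 1 / (a + x)) ` K)"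
  shows "measure lebesgue (cf_shear t ` K)
    \<le> (\<Sum>a\<in>A. measure lebesgue (cf_shear (1 / (a + t)) ` K) / (a + t)\<^sup>2)"
proof -
  define P where "P a = (\<lambda>y. (- 1 / (a + t)\<^sup>2) *\<^sub>R y + 1 / (a + t)) ` cf_shear (1 / (a + t)) ` K" for a
  have compP: "compact (P a)" if "a \<in> A" for a
  proof -
    have "continuous_on K (cf_shear (1 / (a + t)))"
      using assms(2)[OF that] assms(3) K(2) by (intro continuous_on_cf_shear) auto
    then show ?thesis
      unfolding P_def by (intro compact_continuous_image continuous_intros K(1))
  qed
  have sub: "cf_shear t ` K \<subseteq> (\<Union>a\<in>A. P a)"
  proof
    fix y assume "y \<in> cf_shear t ` K"
    then obtain a x where ax: "a \<in> A" "x \<in> K" "y = cf_shear t (1 / (a + x))" using cover by blast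
    then have "y = (- 1 / (a + t)\<^sup>2) *\<^sub>R cf_shear (1 / (a + t)) x + 1 / (a + t)"
      using cf_shear_branch[of a t x] assms(2,3) K(2) by simp
    then show "y \<in> (\<Union>a\<in>A. P a)" unfolding P_def using ax by blast
  qed
  have "measure lebesgue (cf_shear t ` K) \<le> measure lebesgue (\<Union>a\<in>A. P a)"
    using assms(1) compP K continuous_on_cf_shear[OF assms(3), of K]
    by (intro measure_mono_fmeasurable sub fmeasurableD lmeasurable_compact compact_UN
        compact_continuous_image) auto
  also have "\<dots> \<le> (\<Sum>a\<in>A. measure lebesgue (P a))"
    using compP lmeasurable_compact by (intro measure_UNION_le assms(1) fmeasurableD) auto
  also have "\<dots> = (\<Sum>a\<in>A. measure lebesgue (cf_shear (1 / (a + t)) ` K) / (a + t)\<^sup>2)"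
    unfolding P_def measure_lebesgue_affine by simp
  finally show ?thesis .
qed

section \<open>Uniform contraction from the gaps\<close>

text \<open>
  The intervals \<open>{v i..u i}\<close> are ordered from right to left, and consecutive ones do not overlap.
  A positive lower bound for one gap is enough for the contraction.
\<close>

lemma sum_diff_le_gap:
  fixes u v :: "nat \<Rightarrow> real"
  assumes "1 \<le> N" "u 1 + c \<le> v 0" "\<And>i. \<lbrakk>1 \<le> i; i < N\<rbrakk> \<Longrightarrow> u (Suc i) \<le> v i"
  shows "(\<Sum>i\<le>N. u i - v i) \<le> u 0 - v N - c"
  using assms(1,3)
proof (induction N rule: dec_induct)
  case (step N)
  then have "(\<Sum>i\<le>N. u i - v i) \<le> u 0 - v N - c" by simp
  moreover have "u (Suc N) \<le> v N" using step by simp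
  ultimately show ?case by simp
qed (use assms(2) in simp)

lemma cf_shear_contraction:
  fixes e :: "nat \<Rightarrow> real"
  assumes N: "1 \<le> N" and e0: "0 < e 0" and mono: "\<And>i. i \<le> N \<Longrightarrow> e 0 \<le> e i"
    and gap: "\<And>i. i < N \<Longrightarrow> e i + d1 < e (Suc i) + d0"
    and d: "0 \<le> d0" "d0 < d1"
    and ends: "d0 = 1 / (e N + d1)" "d1 = 1 / (e 0 + d0)"
  shows "\<exists>r\<in>{0..<1}. \<forall>t\<in>{0..1 / e 0}.
      (\<Sum>i\<le>N. (cf_shear (1 / (e i + t)) d1 - cf_shear (1 / (e i + t)) d0) / (e i + t)\<^sup>2)
        \<le> r * (cf_shear t d1 - cf_shear t d0)"
proof -
  define B where "B = e 1 + 1 / e 0 + d1"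
  \<comment> \<open>A lower bound, valid for all \<open>t\<close>, for the length of the gap between the images of the
    intervals that belong to the two smallest digits.\<close>
  define c where "c = (e 1 + d0 - (e 0 + d1)) / (B * B)"
  \<comment> \<open>The summand \<open>c\<close> in the denominator only serves to keep \<open>r\<close> nonnegative.\<close>
  define r where "r = 1 - c / (d1 - d0 + c)"
  have e1: "e 0 + d1 < e 1 + d0" "e 0 \<le> e 1" using gap[of 0] mono[of 1] N by auto
  have B: "0 < B" unfolding B_def using e0 e1 d by (intro add_pos_pos) auto
  then have c: "0 < c" unfolding c_def using e1 by simp
  have r: "0 \<le> r" "r < 1" unfolding r_def using c d by (auto simp: divide_simps)
  have main: "(\<Sum>i\<le>N. (cf_shear (1 / (e i + t)) d1 - cf_shear (1 / (e i + t)) d0) / (e i + t)\<^sup>2)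
        \<le> r * (cf_shear t d1 - cf_shear t d0)" if t: "0 \<le> t" "t \<le> 1 / e 0" for t
  proof -
    define u where "u i = 1 / (e i + t + d0)" for i
    define v where "v i = 1 / (e i + t + d1)" for i
    define L where "L = cf_shear t d1 - cf_shear t d0"
    have pos: "0 < e i" if "i \<le> N" for i using mono[OF that] e0 by linarith
    have "(\<Sum>i\<le>N. (cf_shear (1 / (e i + t)) d1 - cf_shear (1 / (e i + t)) d0) / (e i + t)\<^sup>2)
        = (\<Sum>i\<le>N. u i - v i)"
    proof (rule sum.cong[OF refl])
      fix i assume "i \<in> {..N}"
      then have "0 < e i" using pos by simp
      then show "(cf_shear (1 / (e i + t)) d1 - cf_shear (1 / (e i + t)) d0) / (e i + t)\<^sup>2 = u i - v i"
        using cf_shear_scaled[of "e i" t d0] cf_shear_scaled[of "e i" t d1] t d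
        by (simp add: u_def v_def diff_divide_distrib)
    qed
    also have "\<dots> \<le> u 0 - v N - c"
    proof (rule sum_diff_le_gap[OF N])
      have p: "0 < e 0 + t + d1" "0 < e 1 + t + d0" using e0 e1 t d by linarith+
      have "c \<le> (e 1 + d0 - (e 0 + d1)) / ((e 0 + t + d1) * (e 1 + t + d0))"
        unfolding c_def
      proof (rule frac_le)
        show "(e 0 + t + d1) * (e 1 + t + d0) \<le> B * B"
          unfolding B_def using p e0 e1 t d by (intro mult_mono) linarith+
      qed (use e1 p in auto)
      also have "\<dots> = v 0 - u 1"
        unfolding u_def v_def using p by (simp add: divide_simps)
      finally show "u 1 + c \<le> v 0" by simp
    next
      fix i assume "1 \<le> i" "i < N"
      then show "u (Suc i) \<le> v i"
        unfolding u_def v_def using gap[of i] pos[of i] t d by (intro frac_le) auto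
    qed
    also have "u 0 - v N = L"
      unfolding L_def u_def v_def
      using cf_shear_recip[of "e 0" t d0] cf_shear_recip[of "e N" t d1] pos[of N] e0 t d
        ends[symmetric] by simp
    also have "L - c \<le> r * L"
    proof -
      have "cf_shear t d1 - cf_shear t d0 = (d1 - d0) / ((1 + t * d0) * (1 + t * d1))"
      proof -
        have "0 < 1 + t * d0" "0 < 1 + t * d1" using t d by (auto intro!: add_pos_nonneg)
        then show ?thesis by (simp add: cf_shear_def divide_simps) (simp add: algebra_simps)
      qed
      also have "\<dots> \<le> (d1 - d0) / 1"
      proof (rule frac_le)
        show "1 \<le> (1 + t * d0) * (1 + t * d1)"
          using mult_mono[of 1 "1 + t * d0" 1 "1 + t * d1"] t d by simp
      qed (use d in auto)
      finally have "L \<le> d1 - d0 + c" unfolding L_def using c by simp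
      then have "c * L \<le> c * (d1 - d0 + c)" using c by simp
      then have "c / (d1 - d0 + c) * L \<le> c" using c d by (simp add: divide_simps)
      then show ?thesis unfolding r_def by (simp add: left_diff_distrib)
    qed
    finally show ?thesis by (simp add: L_def)
  qed
  show ?thesis using r main by (intro bexI[of _ r]) auto
qed

lemma null_set_of_cf_cover:
  fixes e :: "nat \<Rightarrow> real"
  assumes N: "1 \<le> N" and e0: "0 < e 0" and mono: "\<And>i. i \<le> N \<Longrightarrow> e 0 \<le> e i" and inj: "inj_on e {..N}"
    and gap: "\<And>i. i < N \<Longrightarrow> e i + d1 < e (Suc i) + d0"
    and d: "0 \<le> d0" "d0 < d1"
    and ends: "d0 = 1 / (e N + d1)" "d1 = 1 / (e 0 + d0)"
    and K: "compact K" "K \<subseteq> {d0..d1}"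
    and cover: "K \<subseteq> (\<Union>a\<in>e ` {..N}. (\<lambda>x. 1 / (a + x)) ` K)"
  shows "K \<in> null_sets lebesgue"
proof -
  define T where "T t = cf_shear t d1 - cf_shear t d0" for t
  define m where "m t = measure lebesgue (cf_shear t ` K)" for t
  obtain r where r: "0 \<le> r" "r < 1"
    and contr: "\<And>t. \<lbrakk>0 \<le> t; t \<le> 1 / e 0\<rbrakk> \<Longrightarrow> (\<Sum>i\<le>N. T (1 / (e i + t)) / (e i + t)\<^sup>2) \<le> r * T t"
    using cf_shear_contraction[OF N e0 mono gap d ends, folded T_def] by auto
  have Kpos: "0 \<le> x" if "x \<in> K" for x using that K(2) d(1) by force
  have pos: "0 < e i" if "i \<le> N" for i using mono[OF that] e0 by linarith
  have rec: "m t \<le> (\<Sum>i\<le>N. m (1 / (e i + t)) / (e i + t)\<^sup>2)" if "0 \<le> t" for t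
    using measure_cf_shear_le[OF _ _ that K(1) Kpos cover] pos
    unfolding m_def by (auto simp: sum.reindex[OF inj])
  have iter: "m t \<le> r ^ n * T t" if "0 \<le> t" "t \<le> 1 / e 0" for n t
    using that
  proof (induction n arbitrary: t)
    case 0
    have "cf_shear t ` K \<subseteq> {cf_shear t d0..cf_shear t d1}"
      using K(2) d 0 cf_shear_mono[of t] by fastforce
    moreover have "compact (cf_shear t ` K)"
      by (intro compact_continuous_image continuous_on_cf_shear K(1) Kpos 0(1))
    ultimately have "m t \<le> measure lebesgue {cf_shear t d0..cf_shear t d1}"
      unfolding m_def
      by (rule measure_mono_fmeasurable[OF _ fmeasurableD[OF lmeasurable_compact]]) simp
    also have "\<dots> = T t" unfolding T_def using cf_shear_mono[of t d0 d1] 0 d by simp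
    finally show ?case by simp
  next
    case (Suc n)
    have "m t \<le> (\<Sum>i\<le>N. m (1 / (e i + t)) / (e i + t)\<^sup>2)" by (rule rec[OF Suc.prems(1)])
    also have "\<dots> \<le> (\<Sum>i\<le>N. r ^ n * T (1 / (e i + t)) / (e i + t)\<^sup>2)"
    proof (intro sum_mono divide_right_mono Suc.IH)
      fix i assume i: "i \<in> {..N}"
      show "0 \<le> 1 / (e i + t)" using pos[of i] i Suc.prems by simp
      show "1 / (e i + t) \<le> 1 / e 0" using mono[of i] i e0 Suc.prems by (intro frac_le) auto
    qed simp
    also have "\<dots> = r ^ n * (\<Sum>i\<le>N. T (1 / (e i + t)) / (e i + t)\<^sup>2)"
      by (simp add: sum_distrib_left)
    also have "\<dots> \<le> r ^ n * (r * T t)"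
      using contr[OF Suc.prems] r(1) by (intro mult_left_mono) auto
    finally show ?case by (simp add: mult_ac)
  qed
  have "(\<lambda>n. r ^ n * T 0) \<longlonglongrightarrow> 0"
    using LIMSEQ_realpow_zero[OF r] by (rule tendsto_mult_left_zero)
  then have "m 0 \<le> 0" by (rule LIMSEQ_le_const) (use iter[of 0] e0 in auto)
  then have "measure lebesgue K = 0" unfolding m_def by (simp add: order_antisym)
  then have "negligible K" using K(1) by (simp add: negligible_iff_measure0 lmeasurable_compact)
  then show ?thesis by (simp add: negligible_iff_null_sets)
qed

section \<open>The set of values and its closure\<close>

lemma cf_min_max_recip:
  assumes "0 < l" "l \<le> g"
  shows "0 \<le> cf_min l g" "0 \<le> cf_max l g"
    and "cf_min l g = 1 / (g + cf_max l g)" "cf_max l g = 1 / (l + cf_min l g)"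
proof -
  let ?lg = "\<lambda>k::nat. if odd k then l else g" and ?gl = "\<lambda>k::nat. if odd k then g else l"
  have sw: "(\<lambda>k. ?gl (Suc k)) = ?lg" "(\<lambda>k. ?lg (Suc k)) = ?gl" by auto
  show "0 \<le> cf_min l g" "cf_min l g = 1 / (g + cf_max l g)"
    using cf_value_unfold[of l ?gl] assms sw cf_value_periodic[OF assms] by auto
  show "0 \<le> cf_max l g" "cf_max l g = 1 / (l + cf_min l g)"
    using cf_value_unfold[of l ?lg] assms sw cf_value_periodic[OF assms] by auto
qed

lemma cf_min_less_max:
  assumes "0 < l" "l < g"
  shows "cf_min l g < cf_max l g"
proof -
  note * = cf_min_max_recip[of l g]
  have "cf_min l g * (g + cf_max l g) = 1" "cf_max l g * (l + cf_min l g) = 1"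
    using * assms by (metis add_pos_nonneg less_irrefl less_trans less_imp_le nonzero_divide_eq_eq)+
  then have eq: "cf_min l g * g = cf_max l g * l" by (simp add: algebra_simps)
  have "0 < cf_min l g" using *(2,3) assms by (metis add_pos_nonneg less_trans less_imp_le zero_less_divide_1_iff)
  then have "cf_min l g * l < cf_max l g * l" using eq assms by (metis mult_strict_left_mono)
  then show ?thesis using assms by simp
qed

lemma cf_values_subset_branches:
  assumes "0 < l" "\<And>a. a \<in> A \<Longrightarrow> l \<le> a"
  shows "cf_values A \<subseteq> (\<Union>a\<in>A. (\<lambda>x. 1 / (a + x)) ` cf_values A)"
proof
  fix x assume "x \<in> cf_values A"
  then obtain a where a: "x = cf_value a" "\<forall>n\<ge>1. a n \<in> A" by (auto simp: cf_values_def)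
  have "x = 1 / (a 1 + cf_value (\<lambda>k. a (Suc k)))"
    unfolding a(1) by (rule cf_value_unfold(1)[OF assms(1)]) (use a(2) assms(2) in auto)
  moreover have "a 1 \<in> A" "cf_value (\<lambda>k. a (Suc k)) \<in> cf_values A"
    using a(2) by (auto simp: cf_values_def)
  ultimately show "x \<in> (\<Union>a\<in>A. (\<lambda>x. 1 / (a + x)) ` cf_values A)" by blast
qed

lemma closure_cf_values_cover:
  assumes "finite A" "0 < l" "\<And>a. a \<in> A \<Longrightarrow> l \<le> a"
    and "compact (closure (cf_values A))" "\<And>x. x \<in> closure (cf_values A) \<Longrightarrow> 0 \<le> x"
  shows "closure (cf_values A) \<subseteq> (\<Union>a\<in>A. (\<lambda>x. 1 / (a + x)) ` closure (cf_values A))"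
proof (rule closure_minimal)
  show "cf_values A \<subseteq> (\<Union>a\<in>A. (\<lambda>x. 1 / (a + x)) ` closure (cf_values A))"
  proof (rule order_trans)
    show "cf_values A \<subseteq> (\<Union>a\<in>A. (\<lambda>x. 1 / (a + x)) ` cf_values A)"
      by (rule cf_values_subset_branches[OF assms(2,3)])
  qed (intro UN_mono image_mono closure_subset order_refl)
  have "compact ((\<lambda>x. 1 / (a + x)) ` closure (cf_values A))" if "a \<in> A" for a
  proof -
    have "a + x \<noteq> 0" if "x \<in> closure (cf_values A)" for x
      using assms(2) assms(3)[OF \<open>a \<in> A\<close>] assms(5)[OF that] by linarith
    then show ?thesis
      by (intro compact_continuous_image assms(4) continuous_intros) auto
  qed
  then show "closed (\<Union>a\<in>A. (\<lambda>x. 1 / (a + x)) ` closure (cf_values A))"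
    using assms(1) by (intro compact_imp_closed compact_UN) auto
qed

theorem theorem19:
  fixes s :: nat and e :: "nat \<Rightarrow> real"
  assumes "2 \<le> s"
    and "0 < e 0"
    and "\<And>i. i \<in> {1..s - 1} \<Longrightarrow> e (i - 1) < e i"
    and "\<And>i. i \<in> {1..s - 1} \<Longrightarrow>
           e i - e (i - 1) > cf_max (e 0) (e (s - 1)) - cf_min (e 0) (e (s - 1))"
  shows "nowhere_dense (cf_values (e ` {0..s - 1})) \<and>
         cf_values (e ` {0..s - 1}) \<in> null_sets lebesgue"
proof -
  define N where "N = s - 1"
  define A where "A = e ` {..N}"
  define K where "K = closure (cf_values A)"
  let ?d0 = "cf_min (e 0) (e N)" and ?d1 = "cf_max (e 0) (e N)"
  have N: "1 \<le> N" using assms(1) by (simp add: N_def)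
  have step: "e i < e (Suc i)" if "i < N" for i using assms(3)[of "Suc i"] that by (simp add: N_def)
  have less: "e i < e j" if "i < j" "j \<le> N" for i j
    using that
  proof (induction j rule: less_Suc_induct)
    case (1 i) then show ?case using step by simp
  next
    case (2 i j k) then show ?case by (meson less_imp_le less_le_trans less_trans)
  qed
  have le: "e i \<le> e j" if "i \<le> j" "j \<le> N" for i j
    using less[of i j] that by (cases "i = j") auto
  have inj: "inj_on e {..N}" by (rule inj_onI) (metis atMost_iff less less_irrefl linorder_neqE_nat)
  have gap: "e i + ?d1 < e (Suc i) + ?d0" if "i < N" for i
    using assms(4)[of "Suc i"] that by (simp add: N_def)
  note d = cf_min_max_recip[OF assms(2) le[of 0 N, simplified]]
  have d01: "?d0 < ?d1" using cf_min_less_max[OF assms(2) less[of 0 N]] N by simp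
  have A0: "e 0 \<in> A" "e N \<in> A" by (auto simp: A_def)
  have A: "e 0 \<le> a \<and> a \<le> e N" if "a \<in> A" for a
    using that le by (auto simp: A_def)
  have "cf_values A \<subseteq> {?d0..?d1}"
    using cf_min_least(2)[OF assms(2) A0 A] cf_max_greatest(2)[OF assms(2) A0 A] by auto
  then have Ksub: "K \<subseteq> {?d0..?d1}" unfolding K_def by (rule closure_minimal) simp
  then have Kcomp: "compact K"
    unfolding K_def by (meson bounded_closed_interval bounded_subset closed_closure compact_eq_bounded_closed)
  have "K \<subseteq> (\<Union>a\<in>A. (\<lambda>x. 1 / (a + x)) ` K)"
    unfolding K_def
  proof (rule closure_cf_values_cover[OF _ assms(2)])
    show "0 \<le> x" if "x \<in> closure (cf_values A)" for x
      using that Ksub d(1) unfolding K_def by force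
  qed (use A Kcomp in \<open>auto simp: A_def K_def\<close>)
  then have "K \<in> null_sets lebesgue"
    unfolding A_def
    by (intro null_set_of_cf_cover[OF N assms(2) le inj gap d(1) d01 d(3,4) Kcomp Ksub]) auto
  then have "negligible K" by (simp add: negligible_iff_null_sets)
  then have "interior K = {}"
    using open_not_negligible[of "interior K"] negligible_subset[OF _ interior_subset] by auto
  moreover have "cf_values A \<in> null_sets lebesgue"
    using \<open>negligible K\<close> negligible_subset closure_subset
    unfolding K_def negligible_iff_null_sets by blast
  moreover have "A = e ` {0..s - 1}" unfolding A_def N_def by (simp add: atMost_atLeast0)
  ultimately show ?thesis unfolding nowhere_dense_def K_def by simp
qed

end
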